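(* For each $i\in\{1,2\}$, let $X_i$ be a Banach space and let $V_i$ be a non-empty closed convex subset of $X_i$. Let $X=X_1\oplus_\infty X_2$ and $V=V_1\times V_2$. If $(X_i,V_i,\mathcal{CB}(X_i))$ has property-$(P_1)$ for each $i\in\{1,2\}$, then the map $\mathrm{cent}_V(\cdot)$ is upper Hausdorff semi-continuous on $\mathcal{CB}(X)$.
   Context: All Banach spaces are real. $X_1\oplus_\infty X_2$ is $X_1\times X_2$ with the norm $\|(x_1,x_2)\|=\max\{\|x_1\|,\|x_2\|\}$. For a Banach space $E$, $B_E$ is its closed unit ball and $\mathcal{CB}(E)$ is the class of non-empty closed bounded subsets of $E$, equipped with the Hausdorff metric $d_H(A,B)=\inf\{t>0: A\subseteq B+tB_E,\ B\subseteq A+tB_E\}$. For $v\in E$ and a non-empty bounded set $F\subseteq E$, $r(v,F)=\sup_{z\in F}\|v-z\|$. For a non-empty closed convex $V\subseteq E$: $\mathrm{rad}_V(F)=\inf_{v\in V}r(v,F)$, $\mathrm{cent}_V(F)=\{v\in V: r(v,F)=\mathrm{rad}_V(F)\}$, and for $\delta>0$, $\mathrm{cent}_V(F,\delta)=\{v\in V: r(v,F)\le \mathrm{rad}_V(F)+\delta\}$. For $\mathscr F\subseteq\mathcal{CB}(E)$, the pair $(V,\mathscr F)$ has the restricted center property (r.c.p.) if $\mathrm{cent}_V(F)\ne\emptyset$ for every $F\in\mathscr F$. The triplet $(E,V,\mathscr F)$ has property-$(P_1)$ if $(V,\mathscr F)$ has r.c.p. and for every $\varepsilon>0$ and $F\in\mathscr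 F$ there is $\delta>0$ with $\mathrm{cent}_V(F,\delta)\subseteq\mathrm{cent}_V(F)+\varepsilon B_E$. A set-valued map $\Phi:\mathcal{CB}(E)\to\mathcal{CB}(E)$ (so with non-empty values) is upper Hausdorff semi-continuous on $\mathcal{CB}(E)$ if for each $B\in\mathcal{CB}(E)$ and $\varepsilon>0$ there is $\delta>0$ such that $\Phi(A)\subseteq\Phi(B)+\varepsilon B_E$ for every $A\in\mathcal{CB}(E)$ with $d_H(A,B)<\delta$. *)

theory Defs
  imports "HOL-Analysis.Analysis"
begin

text \<open>
  The library norm on \<^typ>\<open>'a \<times> 'b\<close> is the Euclidean one, so the sum with the maximum
  norm needs a type of its own.
\<close>

datatype ('a, 'b) linf_sum = LInf (lfst: 'a) (lsnd: 'b)

instantiation linf_sum :: (ab_group_add, ab_group_add) ab_group_add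
begin

definition "0 = LInf 0 0"
definition "x + y = LInf (lfst x + lfst y) (lsnd x + lsnd y)"
definition "x - y = LInf (lfst x - lfst y) (lsnd x - lsnd y)"
definition "- x = LInf (- lfst x) (- lsnd x)"

instance
  by standard (simp_all add: zero_linf_sum_def plus_linf_sum_def minus_linf_sum_def
      uminus_linf_sum_def add_ac)

end

instantiation linf_sum :: (real_vector, real_vector) real_vector
begin

definition "r *\<^sub>R x = LInf (r *\<^sub>R lfst x) (r *\<^sub>R lsnd x)"

instance
  by standard (simp_all add: plus_linf_sum_def scaleR_linf_sum_def scaleR_add_left
      scaleR_add_right)

end

instantiation linf_sum :: (real_normed_vector, real_normed_vector) real_normed_vector
begin

definition norm_linf_sum :: "('a, 'b) linf_sum \<Rightarrow> real" where
  "norm_linf_sum x = max (norm (lfst x)) (norm (lsnd x))"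

definition dist_linf_sum :: "('a, 'b) linf_sum \<Rightarrow> ('a, 'b) linf_sum \<Rightarrow> real" where
  "dist_linf_sum x y = norm (x - y)"

definition sgn_linf_sum :: "('a, 'b) linf_sum \<Rightarrow> ('a, 'b) linf_sum" where
  "sgn_linf_sum x = x /\<^sub>R norm x"

definition uniformity_linf_sum :: "(('a, 'b) linf_sum \<times> ('a, 'b) linf_sum) filter" where
  "uniformity_linf_sum = (INF e\<in>{0<..}. principal {(x, y). dist x y < e})"

definition open_linf_sum :: "('a, 'b) linf_sum set \<Rightarrow> bool" where
  "open_linf_sum U \<longleftrightarrow> (\<forall>x\<in>U. eventually (\<lambda>(x', y). x' = x \<longrightarrow> y \<in> U) uniformity)"

instance
proof
  fix x y :: "('a, 'b) linf_sum" and a :: real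
  show "norm x = 0 \<longleftrightarrow> x = 0"
    by (cases x) (auto simp: norm_linf_sum_def zero_linf_sum_def max_def split: if_splits)
  show "norm (x + y) \<le> norm x + norm y"
    using norm_triangle_ineq[of "lfst x" "lfst y"] norm_triangle_ineq[of "lsnd x" "lsnd y"]
    by (simp add: norm_linf_sum_def plus_linf_sum_def max_def)
  show "norm (a *\<^sub>R x) = \<bar>a\<bar> * norm x"
    by (simp add: norm_linf_sum_def scaleR_linf_sum_def max_mult_distrib_left)
qed (rule dist_linf_sum_def sgn_linf_sum_def uniformity_linf_sum_def open_linf_sum_def)+

end

instance linf_sum :: (banach, banach) banach
proof
  fix f :: "nat \<Rightarrow> ('a, 'b) linf_sum"
  assume f: "Cauchy f"
  have fst_le: "dist (lfst x) (lfst y) \<le> dist x y"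
    and snd_le: "dist (lsnd x) (lsnd y) \<le> dist x y" for x y :: "('a, 'b) linf_sum"
    by (simp_all add: dist_norm norm_linf_sum_def minus_linf_sum_def)
  have "Cauchy (\<lambda>n. lfst (f n))" "Cauchy (\<lambda>n. lsnd (f n))"
    using f fst_le snd_le unfolding Cauchy_def by (meson le_less_trans)+
  then obtain a b where a: "(\<lambda>n. lfst (f n)) \<longlonglongrightarrow> a" and b: "(\<lambda>n. lsnd (f n)) \<longlonglongrightarrow> b"
    by (meson Cauchy_convergent convergent_def)
  have "f \<longlonglongrightarrow> LInf a b"
  proof (rule metric_LIMSEQ_I)
    fix e :: real
    assume "0 < e"
    then have "\<forall>\<^sub>F n in sequentially. dist (lfst (f n)) a < e"
      "\<forall>\<^sub>F n in sequentially. dist (lsnd (f n)) b < e"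
      using a b by (auto dest: tendstoD)
    then have "\<forall>\<^sub>F n in sequentially. dist (f n) (LInf a b) < e"
      by eventually_elim (simp add: dist_norm norm_linf_sum_def minus_linf_sum_def)
    then show "\<exists>N. \<forall>n\<ge>N. dist (f n) (LInf a b) < e"
      by (simp add: eventually_sequentially)
  qed
  then show "convergent f"
    by (auto simp: convergent_def)
qed

definition linf_times :: "'a set \<Rightarrow> 'b set \<Rightarrow> ('a, 'b) linf_sum set" where
  "linf_times A B = {LInf a b | a b. a \<in> A \<and> b \<in> B}"

definition CB :: "'a::real_normed_vector set set" where
  "CB = {F. F \<noteq> {} \<and> closed F \<and> bounded F}"

text \<open>\<open>enlarge A t\<close> is $A + t B_E$.\<close>

definition enlarge :: "'a::real_normed_vector set \<Rightarrow> real \<Rightarrow> 'a set" where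
  "enlarge A t = {a + t *\<^sub>R b | a b. a \<in> A \<and> b \<in> cball 0 1}"

definition hausdorff_dist :: "'a::real_normed_vector set \<Rightarrow> 'a set \<Rightarrow> real" where
  "hausdorff_dist A B = Inf {t. t > 0 \<and> A \<subseteq> enlarge B t \<and> B \<subseteq> enlarge A t}"

text \<open>
  The real-valued suprema and infima below are the intended ones only for non-empty bounded
  \<open>F\<close> and non-empty \<open>V\<close>.
\<close>

definition radius_at :: "'a::real_normed_vector \<Rightarrow> 'a set \<Rightarrow> real" where
  "radius_at v F = (SUP z\<in>F. norm (v - z))"

definition rad :: "'a::real_normed_vector set \<Rightarrow> 'a set \<Rightarrow> real" where
  "rad V F = (INF v\<in>V. radius_at v F)"

definition cent :: "'a::real_normed_vector set \<Rightarrow> 'a set \<Rightarrow> 'a set" where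
  "cent V F = {v \<in> V. radius_at v F = rad V F}"

definition near_cent :: "'a::real_normed_vector set \<Rightarrow> 'a set \<Rightarrow> real \<Rightarrow> 'a set" where
  "near_cent V F \<delta> = {v \<in> V. radius_at v F \<le> rad V F + \<delta>}"

definition rcp :: "'a::real_normed_vector set \<Rightarrow> 'a set set \<Rightarrow> bool" where
  "rcp V \<F> \<longleftrightarrow> (\<forall>F\<in>\<F>. cent V F \<noteq> {})"

definition property_P1 :: "'a::real_normed_vector set \<Rightarrow> 'a set set \<Rightarrow> bool" where
  "property_P1 V \<F> \<longleftrightarrow> rcp V \<F> \<and>
    (\<forall>\<epsilon>>0. \<forall>F\<in>\<F>. \<exists>\<delta>>0. near_cent V F \<delta> \<subseteq> enlarge (cent V F) \<epsilon>)"

text \<open>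
  The first conjunct says that \<open>\<Phi>\<close> really is a map from \<open>CB\<close> to \<open>CB\<close>; in particular
  its values there are non-empty.
\<close>

definition upper_Hausdorff_semicontinuous ::
  "('a::real_normed_vector set \<Rightarrow> 'a set) \<Rightarrow> bool" where
  "upper_Hausdorff_semicontinuous \<Phi> \<longleftrightarrow> \<Phi> \<in> CB \<rightarrow> CB \<and>
    (\<forall>B\<in>CB. \<forall>\<epsilon>>0. \<exists>\<delta>>0. \<forall>A\<in>CB. hausdorff_dist A B < \<delta> \<longrightarrow> \<Phi> A \<subseteq> enlarge (\<Phi> B) \<epsilon>)"

end

theory Submission imports Defs begin

text \<open>
  In \<open>X\<close> the function \<open>r(\<cdot>, F)\<close> is the maximum of the functions \<open>r(\<cdot>, F\<^sub>i)\<close> of the two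
  projections of \<open>F\<close>, so the sublevel sets of \<open>r(\<cdot>, F)\<close> on \<open>V\<close> are products of sublevel sets at the
  same level. For a factor with \<open>rad\<close> equal to the level \<open>R = rad\<^sub>V(F)\<close>, the sublevel sets slightly
  above \<open>R\<close> are close to the one at \<open>R\<close> by property $(P_1)$. For a factor with smaller \<open>rad\<close> they
  are close by convexity: moving a point a little towards a centre lowers \<open>r\<close> below \<open>R\<close>.
  Hence \<open>(X, V, CB)\<close> has property $(P_1)$. Semi-continuity follows because \<open>r(v, \<cdot>)\<close>, and
  therefore \<open>rad\<^sub>V\<close>, is 1-Lipschitz in the Hausdorff distance, so that \<open>cent\<^sub>V(A)\<close> consists of
  near-centres of \<open>B\<close> whenever \<open>A\<close> is close to \<open>B\<close>.
\<close>

section \<open>Enlargements and the function r(v, F) on a normed space\<close>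

lemma mem_enlarge_iff:
  fixes x :: "'a::real_normed_vector"
  assumes "t > 0"
  shows "x \<in> enlarge A t \<longleftrightarrow> (\<exists>a\<in>A. norm (x - a) \<le> t)"
proof
  assume "x \<in> enlarge A t"
  then obtain a b where "a \<in> A" "norm b \<le> 1" "x = a + t *\<^sub>R b"
    by (auto simp: enlarge_def)
  with assms show "\<exists>a\<in>A. norm (x - a) \<le> t"
    by (intro bexI[of _ a]) (auto simp: mult_left_le)
next
  assume "\<exists>a\<in>A. norm (x - a) \<le> t"
  then obtain a where a: "a \<in> A" "norm (x - a) \<le> t"
    by auto
  have "x = a + t *\<^sub>R ((1/t) *\<^sub>R (x - a))"
    using assms by simp
  moreover have "norm ((1/t) *\<^sub>R (x - a)) \<le> 1"
    using a assms by (simp del: scaleR_right_diff_distrib)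
  ultimately show "x \<in> enlarge A t"
    using a(1) unfolding enlarge_def mem_Collect_eq mem_cball_0 by blast
qed

lemma norm_le_radius_at:
  fixes v :: "'a::real_normed_vector"
  assumes "bounded F" "z \<in> F"
  shows "norm (v - z) \<le> radius_at v F"
  unfolding radius_at_def
proof (rule cSUP_upper)
  show "bdd_above ((\<lambda>z. norm (v - z)) ` F)"
    using \<open>bounded F\<close> unfolding bounded_any_center[of _ v]
    by (auto simp: bdd_above_def dist_norm)
qed fact

lemma radius_at_le:
  assumes "F \<noteq> {}" "\<And>z. z \<in> F \<Longrightarrow> norm (v - z) \<le> c"
  shows "radius_at v F \<le> c"
  unfolding radius_at_def using assms by (rule cSUP_least)

lemma radius_at_nonneg:
  fixes v :: "'a::real_normed_vector"
  assumes "bounded F" "F \<noteq> {}"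
  shows "0 \<le> radius_at v F"
proof -
  obtain z where "z \<in> F"
    using assms by auto
  then show ?thesis
    using order_trans[OF norm_ge_zero norm_le_radius_at[OF assms(1)]] by blast
qed

text \<open>Any point of \<open>F\<close> serves as an intermediate point between \<open>v\<close>
  and \<open>w\<close>. This bounds the diameter of \<open>cent V F\<close>, and later the distance
  from a near-centre to a centre.\<close>

lemma norm_diff_le_radius_at:
  fixes v w :: "'a::real_normed_vector"
  assumes "bounded F" "F \<noteq> {}"
  shows "norm (v - w) \<le> radius_at v F + radius_at w F"
proof -
  obtain z where "z \<in> F"
    using assms by auto
  then show ?thesis
    using norm_le_radius_at[OF assms(1), of z v] norm_le_radius_at[OF assms(1), of z w]
      norm_triangle_ineq4[of "v - z" "w - z"] by simp
qed

lemma radius_at_lipschitz: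
  fixes v w :: "'a::real_normed_vector"
  assumes "bounded F" "F \<noteq> {}"
  shows "radius_at v F \<le> radius_at w F + norm (v - w)"
proof (rule radius_at_le[OF assms(2)])
  fix z assume "z \<in> F"
  then show "norm (v - z) \<le> radius_at w F + norm (v - w)"
    using norm_le_radius_at[OF assms(1), of z w] norm_triangle_ineq[of "v - w" "w - z"] by simp
qed

lemma continuous_on_radius_at:
  fixes F :: "'a::real_normed_vector set"
  assumes "bounded F" "F \<noteq> {}"
  shows "continuous_on S (\<lambda>v. radius_at v F)"
proof -
  have "\<bar>radius_at v F - radius_at w F\<bar> \<le> norm (v - w)" for v w
    using radius_at_lipschitz[OF assms, of v w] radius_at_lipschitz[OF assms, of w v]
    by (simp add: abs_le_iff norm_minus_commute)
  then show ?thesis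
    unfolding continuous_on_iff dist_norm real_norm_def by (blast intro: le_less_trans)
qed

text \<open>A closed ball around \<open>v\<close> that contains \<open>F\<close> also contains its
  closure. This is what allows projections of \<open>F\<close> to be replaced by their closures,
  which lie in \<open>CB\<close>.\<close>

lemma radius_at_closure:
  fixes v :: "'a::real_normed_vector"
  assumes "bounded F" "F \<noteq> {}"
  shows "radius_at v (closure F) = radius_at v F"
proof (rule antisym)
  show "radius_at v (closure F) \<le> radius_at v F"
  proof (rule radius_at_le)
    have "F \<subseteq> cball v (radius_at v F)"
      using norm_le_radius_at[OF assms(1)] by (auto simp: dist_norm)
    then have "closure F \<subseteq> cball v (radius_at v F)"
      by (simp add: closure_minimal)
    then show "norm (v - z) \<le> radius_at v F" if "z \<in> closure F" for z
      using that by (auto simp: dist_norm)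
  qed (use assms in simp)
  show "radius_at v F \<le> radius_at v (closure F)"
    using assms closure_subset by (intro radius_at_le norm_le_radius_at) auto
qed

lemma radius_at_convex_combination:
  fixes v w :: "'a::real_normed_vector"
  assumes "bounded F" "F \<noteq> {}" "0 \<le> t" "t \<le> 1"
  shows "radius_at ((1 - t) *\<^sub>R v + t *\<^sub>R w) F \<le> (1 - t) * radius_at v F + t * radius_at w F"
proof (rule radius_at_le[OF assms(2)])
  fix z assume z: "z \<in> F"
  have "(1 - t) *\<^sub>R v + t *\<^sub>R w - z = (1 - t) *\<^sub>R (v - z) + t *\<^sub>R (w - z)"
    by (simp add: algebra_simps)
  then have "norm ((1 - t) *\<^sub>R v + t *\<^sub>R w - z) \<le> (1 - t) * norm (v - z) + t * norm (w - z)"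
    using norm_triangle_ineq[of "(1 - t) *\<^sub>R (v - z)" "t *\<^sub>R (w - z)"] assms by simp
  also have "\<dots> \<le> (1 - t) * radius_at v F + t * radius_at w F"
    using assms z by (intro add_mono mult_left_mono norm_le_radius_at) auto
  finally show "norm ((1 - t) *\<^sub>R v + t *\<^sub>R w - z) \<le> (1 - t) * radius_at v F + t * radius_at w F" .
qed

section \<open>Restricted radius and restricted centres\<close>

lemma rad_le_radius_at:
  fixes v :: "'a::real_normed_vector"
  assumes "bounded F" "F \<noteq> {}" "v \<in> V"
  shows "rad V F \<le> radius_at v F"
  unfolding rad_def
  using assms by (intro cINF_lower bdd_belowI2[where m = 0] radius_at_nonneg)

text \<open>Points of \<open>V\<close> never fall below the infimum \<open>rad V F\<close>. With an
  inequality in place of the equation, membership splits over the two factors once r is a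
  maximum.\<close>

lemma cent_eq_sublevel:
  fixes V :: "'a::real_normed_vector set"
  assumes "bounded F" "F \<noteq> {}"
  shows "cent V F = {v \<in> V. radius_at v F \<le> rad V F}"
  using rad_le_radius_at[OF assms] by (auto simp: cent_def intro: antisym)

lemma closed_cent:
  fixes V :: "'a::real_normed_vector set"
  assumes "bounded F" "F \<noteq> {}" "closed V"
  shows "closed (cent V F)"
  unfolding cent_def
  using continuous_closed_preimage_constant[OF continuous_on_radius_at[OF assms(1,2)] assms(3)] .

lemma bounded_cent:
  fixes V :: "'a::real_normed_vector set"
  assumes "bounded F" "F \<noteq> {}"
  shows "bounded (cent V F)"
proof -
  have "norm (v - w) \<le> rad V F + rad V F" if "v \<in> cent V F" "w \<in> cent V F" for v w
    using that norm_diff_le_radius_at[OF assms, of v w] by (simp add: cent_def)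
  then show ?thesis
    unfolding bounded_two_points dist_norm by blast
qed

section \<open>Hausdorff distance and semi-continuity from property-$(P_1)$\<close>

lemma hausdorff_dist_lessE:
  fixes A B :: "'a::real_normed_vector set"
  assumes "A \<in> CB" "B \<in> CB" "hausdorff_dist A B < \<delta>"
  obtains t where "t > 0" "t < \<delta>" "A \<subseteq> enlarge B t" "B \<subseteq> enlarge A t"
proof -
  obtain e where e: "\<forall>x\<in>A \<union> B. \<forall>y\<in>A \<union> B. dist x y \<le> e"
    using assms(1,2) bounded_two_points[of "A \<union> B"] by (auto simp: CB_def)
  obtain a b where ab: "a \<in> A" "b \<in> B"
    using assms(1,2) by (auto simp: CB_def)
  \<comment> \<open>Extracting \<open>t\<close> from the infimum requires that some admissible
    \<open>t\<close> exists. Any positive number at least the diameter bound \<open>e\<close> is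
    one; the absolute value and the added 1 ensure positivity.\<close>
  have pos: "\<bar>e\<bar> + 1 > 0"
    by simp
  have "norm (x - y) \<le> \<bar>e\<bar> + 1" if "x \<in> A \<union> B" "y \<in> A \<union> B" for x y
    using bspec[OF bspec[OF e that(1)] that(2)] by (simp add: dist_norm)
  then have "A \<subseteq> enlarge B (\<bar>e\<bar> + 1)" "B \<subseteq> enlarge A (\<bar>e\<bar> + 1)"
    using ab unfolding subset_iff mem_enlarge_iff[OF pos] by blast+
  then have "{t. t > 0 \<and> A \<subseteq> enlarge B t \<and> B \<subseteq> enlarge A t} \<noteq> {}"
    using pos by blast
  from cInf_lessD[OF this] assms(3) that show thesis
    unfolding hausdorff_dist_def by blast
qed

lemma radius_at_le_enlarge:
  fixes A B :: "'a::real_normed_vector set"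
  assumes "A \<noteq> {}" "bounded B" "A \<subseteq> enlarge B t" "t > 0"
  shows "radius_at v A \<le> radius_at v B + t"
proof (rule radius_at_le[OF assms(1)])
  fix z assume "z \<in> A"
  then obtain b where "b \<in> B" "norm (z - b) \<le> t"
    using assms mem_enlarge_iff[OF assms(4)] by blast
  then show "norm (v - z) \<le> radius_at v B + t"
    using norm_le_radius_at[OF assms(2), of b v] norm_triangle_ineq4[of "v - b" "z - b"] by simp
qed

lemma rad_le_enlarge:
  fixes A B V :: "'a::real_normed_vector set"
  assumes "V \<noteq> {}" "A \<noteq> {}" "bounded A" "bounded B" "A \<subseteq> enlarge B t" "t > 0"
  shows "rad V A \<le> rad V B + t"
proof -
  have "rad V A - t \<le> radius_at v B" if "v \<in> V" for v
    using rad_le_radius_at[OF assms(3,2) that] radius_at_le_enlarge[OF assms(2,4-6), of v] by simp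
  then have "rad V A - t \<le> rad V B"
    unfolding rad_def[of V B] using assms(1) by (intro cINF_greatest)
  then show ?thesis
    by simp
qed

lemma upper_Hausdorff_semicontinuous_cent:
  fixes V :: "'a::real_normed_vector set"
  assumes "closed V" "property_P1 V CB"
  shows "upper_Hausdorff_semicontinuous (cent V)"
  unfolding upper_Hausdorff_semicontinuous_def
proof (intro conjI ballI allI impI)
  have ne: "cent V F \<noteq> {}" if "F \<in> CB" for F
    using assms(2) that by (auto simp: property_P1_def rcp_def)
  then show "cent V \<in> CB \<rightarrow> CB"
    using assms(1) by (simp add: CB_def Pi_iff closed_cent bounded_cent)
  fix B :: "'a set" and \<epsilon> :: real
  assume B: "B \<in> CB" and "\<epsilon> > 0"
  then obtain \<delta> where \<delta>: "\<delta> > 0" "near_cent V B \<delta> \<subseteq> enlarge (cent V B) \<epsilon>"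
    using assms(2) unfolding property_P1_def by blast
  \<comment> \<open>The half accounts for losing \<open>t\<close> twice: once from
    \<open>radius_at v B\<close> to \<open>radius_at v A\<close>, and once from
    \<open>rad V A\<close> to \<open>rad V B\<close>.\<close>
  have "cent V A \<subseteq> enlarge (cent V B) \<epsilon>"
    if A: "A \<in> CB" and d: "hausdorff_dist A B < \<delta> / 2" for A
  proof -
    obtain t where t: "t > 0" "t < \<delta> / 2" "A \<subseteq> enlarge B t" "B \<subseteq> enlarge A t"
      using hausdorff_dist_lessE[OF A B d] .
    have bd: "A \<noteq> {}" "bounded A" "B \<noteq> {}" "bounded B"
      using A B by (auto simp: CB_def)
    \<comment> \<open>A centre of \<open>A\<close> is a point of \<open>V\<close>, so the infimum
      defining \<open>rad V B\<close> is a genuine one.\<close>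
    have "V \<noteq> {}"
      using ne[OF A] by (auto simp: cent_def)
    then have rad: "rad V A \<le> rad V B + t"
      using bd t by (intro rad_le_enlarge)
    have radius: "radius_at v B \<le> radius_at v A + t" for v
      using bd t by (intro radius_at_le_enlarge)
    have "radius_at v B \<le> rad V B + \<delta>" if "radius_at v A = rad V A" for v
      using that t(1,2) rad radius[of v] by linarith
    then have "cent V A \<subseteq> near_cent V B \<delta>"
      by (auto simp: near_cent_def cent_def)
    with \<delta>(2) show ?thesis
      by blast
  qed
  then show "\<exists>\<delta>>0. \<forall>A\<in>CB. hausdorff_dist A B < \<delta> \<longrightarrow> cent V A \<subseteq> enlarge (cent V B) \<epsilon>"
    using \<delta>(1) by (intro exI[of _ "\<delta> / 2"]) auto
qed

section \<open>Stability of the sublevel sets of r(v, F) at levels at or above the restricted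
  radius\<close>

lemma sublevel_above_rad:
  fixes V :: "'a::real_normed_vector set"
  assumes "convex V" "bounded F" "F \<noteq> {}" "c \<in> cent V F" "rad V F < R" "\<epsilon> > 0"
  shows "\<exists>\<delta>>0. \<forall>v\<in>V. radius_at v F \<le> R + \<delta> \<longrightarrow>
    (\<exists>w\<in>V. radius_at w F \<le> R \<and> norm (v - w) \<le> \<epsilon>)"
proof -
  define m where "m = rad V F"
  have c: "c \<in> V" "radius_at c F = m"
    using assms(4) by (auto simp: cent_def m_def)
  have m: "0 \<le> m" "m < R"
    using radius_at_nonneg[OF assms(2,3), of c] c assms(5) by (auto simp: m_def)
  \<comment> \<open>The cap 1 gives \<open>norm (v - c)\<close> at most \<open>R + 1 + m\<close>.
    The step length \<open>t\<close> below is at most \<open>\<delta> / (R - m)\<close>, so the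
    second bound keeps the displacement \<open>t * norm (v - c)\<close> within \<epsilon>.\<close>
  define \<delta> where "\<delta> = min 1 (\<epsilon> * (R - m) / (R + 1 + m))"
  have \<delta>: "\<delta> > 0" "\<delta> \<le> 1" "\<delta> \<le> \<epsilon> * (R - m) / (R + 1 + m)"
    using m assms(6) by (auto simp: \<delta>_def)
  have "\<exists>w\<in>V. radius_at w F \<le> R \<and> norm (v - w) \<le> \<epsilon>"
    if v: "v \<in> V" "radius_at v F \<le> R + \<delta>" for v
  proof -
    \<comment> \<open>This \<open>t\<close> solves
      \<open>(1 - t) * (R + \<delta>) + t * m = R\<close>: by convexity, moving the fraction
      \<open>t\<close> of the way to the centre \<open>c\<close> brings r down to level
      \<open>R\<close>.\<close>
    define t where "t = \<delta> / (R + \<delta> - m)"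
    define w where "w = (1 - t) *\<^sub>R v + t *\<^sub>R c"
    have t: "0 \<le> t" "t \<le> 1" "t * (R + \<delta> - m) = \<delta>"
      using m \<delta> by (auto simp: t_def)
    have "w \<in> V"
      using assms(1) v c t by (auto simp: w_def convex_def)
    moreover have "radius_at w F \<le> R"
    proof -
      have "radius_at w F \<le> (1 - t) * radius_at v F + t * m"
        using radius_at_convex_combination[OF assms(2,3) t(1,2), of v c] c by (simp add: w_def)
      also have "\<dots> \<le> (1 - t) * (R + \<delta>) + t * m"
        using v t by (intro add_right_mono mult_left_mono) auto
      also have "\<dots> = R"
        using t(3) by (simp add: algebra_simps)
      finally show ?thesis .
    qed
    moreover have "norm (v - w) \<le> \<epsilon>"
    proof -
      have "v - w = t *\<^sub>R (v - c)"
        by (simp add: w_def algebra_simps)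
      then have "norm (v - w) = t * norm (v - c)"
        using t by simp
      also have "\<dots> \<le> t * (R + 1 + m)"
        using norm_diff_le_radius_at[OF assms(2,3), of v c] v c t \<delta>
        by (intro mult_left_mono) auto
      also have "\<dots> \<le> \<delta> / (R - m) * (R + 1 + m)"
        using m \<delta> by (intro mult_right_mono) (auto simp: t_def frac_le)
      also have "\<dots> \<le> \<epsilon>"
        using \<delta>(3) m by (simp add: field_simps)
      finally show ?thesis .
    qed
    ultimately show ?thesis
      by blast
  qed
  with \<delta>(1) show ?thesis
    by blast
qed

text \<open>In a product the common level \<open>R\<close> may exceed the restricted radius of one
  factor, so property-$(P_1)$ is needed at every such level. If \<open>R\<close> equals
  \<open>rad V F\<close>, the sets involved are \<open>near_cent\<close> and \<open>cent\<close>
  themselves; otherwise there is room to move towards a centre.\<close>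

lemma sublevel_stability:
  fixes V :: "'a::real_normed_vector set"
  assumes "convex V" "property_P1 V CB" "F \<in> CB" "rad V F \<le> R" "\<epsilon> > 0"
  shows "\<exists>\<delta>>0. \<forall>v\<in>V. radius_at v F \<le> R + \<delta> \<longrightarrow>
    (\<exists>w\<in>V. radius_at w F \<le> R \<and> norm (v - w) \<le> \<epsilon>)"
proof (cases "rad V F = R")
  case True
  obtain \<delta> where "\<delta> > 0" "near_cent V F \<delta> \<subseteq> enlarge (cent V F) \<epsilon>"
    using assms(2,3,5) unfolding property_P1_def by blast
  moreover have "\<exists>w\<in>V. radius_at w F \<le> R \<and> norm (v - w) \<le> \<epsilon>"
    if "v \<in> enlarge (cent V F) \<epsilon>" for v
    using that True by (force simp: mem_enlarge_iff[OF assms(5)] cent_def)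
  ultimately show ?thesis
    using True by (auto simp: near_cent_def)
next
  case False
  have "bounded F" "F \<noteq> {}"
    using assms(3) by (auto simp: CB_def)
  moreover obtain c where "c \<in> cent V F"
    using assms(2,3) unfolding property_P1_def rcp_def by blast
  ultimately show ?thesis
    using sublevel_above_rad[of V F c R \<epsilon>] assms False by auto
qed

section \<open>The maximum-norm sum and its projections\<close>

lemma lfst_diff [simp]: "lfst (x - y) = lfst x - lfst y"
  and lsnd_diff [simp]: "lsnd (x - y) = lsnd x - lsnd y"
  by (simp_all add: minus_linf_sum_def)

lemma continuous_on_lfst: "continuous_on S lfst"
  and continuous_on_lsnd: "continuous_on S lsnd"
proof -
  show "continuous_on S lfst" "continuous_on S lsnd"
    by (auto simp: continuous_on_iff dist_norm norm_linf_sum_def)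
qed

lemma bounded_lfst_image:
  fixes F :: "('a::real_normed_vector, 'b::real_normed_vector) linf_sum set"
  shows "bounded F \<Longrightarrow> bounded (lfst ` F)"
  by (auto simp: bounded_iff norm_linf_sum_def)

lemma bounded_lsnd_image:
  fixes F :: "('a::real_normed_vector, 'b::real_normed_vector) linf_sum set"
  shows "bounded F \<Longrightarrow> bounded (lsnd ` F)"
  by (auto simp: bounded_iff norm_linf_sum_def)

lemma mem_linf_times_iff: "x \<in> linf_times A B \<longleftrightarrow> lfst x \<in> A \<and> lsnd x \<in> B"
  by (cases x) (auto simp: linf_times_def)

lemma closed_linf_times:
  fixes A :: "'a::real_normed_vector set" and B :: "'b::real_normed_vector set"
  assumes "closed A" "closed B"
  shows "closed (linf_times A B)"
proof -
  have "linf_times A B = lfst -` A \<inter> lsnd -` B"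
    by (auto simp: mem_linf_times_iff)
  then show ?thesis
    using assms by (simp add: closed_Int closed_vimage continuous_on_lfst continuous_on_lsnd)
qed

text \<open>The supremum of a maximum is the maximum of the suprema. Closures appear because a
  projection of a closed bounded set need not be closed, while the factor hypotheses concern
  \<open>CB\<close>.\<close>

lemma radius_at_linf_sum:
  fixes v :: "('a::real_normed_vector, 'b::real_normed_vector) linf_sum"
  assumes "bounded F" "F \<noteq> {}"
  shows "radius_at v F =
    max (radius_at (lfst v) (closure (lfst ` F))) (radius_at (lsnd v) (closure (lsnd ` F)))"
proof -
  have bd: "bounded (lfst ` F)" "bounded (lsnd ` F)" "lfst ` F \<noteq> {}" "lsnd ` F \<noteq> {}"
    using assms by (auto intro: bounded_lfst_image bounded_lsnd_image)
  have "radius_at v F = max (radius_at (lfst v) (lfst ` F)) (radius_at (lsnd v) (lsnd ` F))"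
  proof (rule antisym)
    show "radius_at v F \<le> max (radius_at (lfst v) (lfst ` F)) (radius_at (lsnd v) (lsnd ` F))"
      using bd by (intro radius_at_le[OF assms(2)])
        (simp only: norm_linf_sum_def lfst_diff lsnd_diff max.mono norm_le_radius_at imageI)
    have "norm (lfst v - lfst z) \<le> radius_at v F" "norm (lsnd v - lsnd z) \<le> radius_at v F"
      if "z \<in> F" for z
      using norm_le_radius_at[OF assms(1) that, of v] by (auto simp: norm_linf_sum_def)
    then show "max (radius_at (lfst v) (lfst ` F)) (radius_at (lsnd v) (lsnd ` F)) \<le> radius_at v F"
      using bd by (auto intro!: radius_at_le)
  qed
  then show ?thesis
    using bd by (simp add: radius_at_closure)
qed

text \<open>The centres of \<open>F\<close> form the product of the sublevel sets of the two factors
  at the common level \<open>R\<close>, which can be larger than the product of the two sets of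
  centres. Hence each factor is approximated at level \<open>R\<close>, and the two approximants are
  paired.\<close>

lemma property_P1_linf_times:
  fixes V\<^sub>1 :: "'a::real_normed_vector set" and V\<^sub>2 :: "'b::real_normed_vector set"
  assumes "convex V\<^sub>1" "convex V\<^sub>2" "property_P1 V\<^sub>1 CB" "property_P1 V\<^sub>2 CB"
  shows "property_P1 (linf_times V\<^sub>1 V\<^sub>2) CB"
proof -
  let ?V = "linf_times V\<^sub>1 V\<^sub>2"
  have "cent ?V F \<noteq> {} \<and> (\<forall>\<epsilon>>0. \<exists>\<delta>>0. near_cent ?V F \<delta> \<subseteq> enlarge (cent ?V F) \<epsilon>)"
    if "F \<in> CB" for F
  proof -
    have F: "bounded F" "F \<noteq> {}"
      using that by (auto simp: CB_def)
    define F\<^sub>1 where "F\<^sub>1 = closure (lfst ` F)"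
    define F\<^sub>2 where "F\<^sub>2 = closure (lsnd ` F)"
    have CB: "F\<^sub>1 \<in> CB" "F\<^sub>2 \<in> CB"
      using F by (auto simp: CB_def F\<^sub>1_def F\<^sub>2_def intro: bounded_lfst_image bounded_lsnd_image)
    have radius: "radius_at v F = max (radius_at (lfst v) F\<^sub>1) (radius_at (lsnd v) F\<^sub>2)" for v
      unfolding F\<^sub>1_def F\<^sub>2_def using F by (rule radius_at_linf_sum)
    define R where "R = max (rad V\<^sub>1 F\<^sub>1) (rad V\<^sub>2 F\<^sub>2)"
    obtain c\<^sub>1 c\<^sub>2 where c: "c\<^sub>1 \<in> cent V\<^sub>1 F\<^sub>1" "c\<^sub>2 \<in> cent V\<^sub>2 F\<^sub>2"
      using assms(3,4) CB by (fastforce simp: property_P1_def rcp_def)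
    then have c_mem: "LInf c\<^sub>1 c\<^sub>2 \<in> ?V" and c_radius: "radius_at (LInf c\<^sub>1 c\<^sub>2) F = R"
      by (auto simp: cent_def mem_linf_times_iff radius R_def)
    \<comment> \<open>\<open>R\<close> is a lower bound factor by factor and is attained at the pair
      of centres, so it equals \<open>rad ?V F\<close>.\<close>
    have "R \<le> radius_at v F" if "v \<in> ?V" for v
      using that CB unfolding radius R_def
      by (intro max.mono rad_le_radius_at) (auto simp: CB_def mem_linf_times_iff)
    then have "R \<le> rad ?V F"
      unfolding rad_def using c_mem by (intro cINF_greatest) auto
    then have rad: "rad ?V F = R"
      using rad_le_radius_at[OF F c_mem] c_radius by simp
    have "\<exists>\<delta>>0. near_cent ?V F \<delta> \<subseteq> enlarge (cent ?V F) \<epsilon>" if \<epsilon>: "\<epsilon> > 0" for \<epsilon>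
    proof -
      obtain \<delta>\<^sub>1 where \<delta>1: "\<delta>\<^sub>1 > 0" "\<And>v. v \<in> V\<^sub>1 \<Longrightarrow> radius_at v F\<^sub>1 \<le> R + \<delta>\<^sub>1 \<Longrightarrow>
          \<exists>w\<in>V\<^sub>1. radius_at w F\<^sub>1 \<le> R \<and> norm (v - w) \<le> \<epsilon>"
        using sublevel_stability[OF assms(1,3) CB(1) _ \<epsilon>, of R] by (auto simp: R_def)
      obtain \<delta>\<^sub>2 where \<delta>2: "\<delta>\<^sub>2 > 0" "\<And>v. v \<in> V\<^sub>2 \<Longrightarrow> radius_at v F\<^sub>2 \<le> R + \<delta>\<^sub>2 \<Longrightarrow>
          \<exists>w\<in>V\<^sub>2. radius_at w F\<^sub>2 \<le> R \<and> norm (v - w) \<le> \<epsilon>"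
        using sublevel_stability[OF assms(2,4) CB(2) _ \<epsilon>, of R] by (auto simp: R_def)
      \<comment> \<open>Since r is a maximum, a near-centre satisfies both factor bounds. Since the
        norm is a maximum too, errors of at most \<epsilon> in each coordinate give a total error of
        at most \<epsilon>.\<close>
      have "v \<in> enlarge (cent ?V F) \<epsilon>" if "v \<in> near_cent ?V F (min \<delta>\<^sub>1 \<delta>\<^sub>2)" for v
      proof -
        have v: "lfst v \<in> V\<^sub>1" "lsnd v \<in> V\<^sub>2"
          "radius_at (lfst v) F\<^sub>1 \<le> R + \<delta>\<^sub>1" "radius_at (lsnd v) F\<^sub>2 \<le> R + \<delta>\<^sub>2"
          using that by (auto simp: near_cent_def mem_linf_times_iff radius rad)
        obtain w\<^sub>1 w\<^sub>2 where w: "w\<^sub>1 \<in> V\<^sub>1" "radius_at w\<^sub>1 F\<^sub>1 \<le> R" "norm (lfst v - w\<^sub>1) \<le> \<epsilon>"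
          "w\<^sub>2 \<in> V\<^sub>2" "radius_at w\<^sub>2 F\<^sub>2 \<le> R" "norm (lsnd v - w\<^sub>2) \<le> \<epsilon>"
          using \<delta>1(2)[OF v(1,3)] \<delta>2(2)[OF v(2,4)] by blast
        have "LInf w\<^sub>1 w\<^sub>2 \<in> cent ?V F"
          using w by (simp add: cent_eq_sublevel[OF F] rad radius mem_linf_times_iff)
        moreover have "norm (v - LInf w\<^sub>1 w\<^sub>2) \<le> \<epsilon>"
          using w by (simp add: norm_linf_sum_def)
        ultimately show ?thesis
          using mem_enlarge_iff[OF \<epsilon>] by blast
      qed
      then show ?thesis
        using \<delta>1(1) \<delta>2(1) by (intro exI[of _ "min \<delta>\<^sub>1 \<delta>\<^sub>2"]) auto
    qed
    moreover have "LInf c\<^sub>1 c\<^sub>2 \<in> cent ?V F"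
      using c_mem c_radius rad by (simp add: cent_def)
    ultimately show ?thesis
      by blast
  qed
  then show ?thesis
    by (simp add: property_P1_def rcp_def)
qed

theorem proposition4p2:
  fixes V\<^sub>1 :: "'a::banach set" and V\<^sub>2 :: "'b::banach set"
  assumes "V\<^sub>1 \<noteq> {}" and "closed V\<^sub>1" and "convex V\<^sub>1"
    and "V\<^sub>2 \<noteq> {}" and "closed V\<^sub>2" and "convex V\<^sub>2"
    and "property_P1 V\<^sub>1 CB"
    and "property_P1 V\<^sub>2 CB"
  shows "upper_Hausdorff_semicontinuous (cent (linf_times V\<^sub>1 V\<^sub>2))"
  using assms
  by (intro upper_Hausdorff_semicontinuous_cent closed_linf_times property_P1_linf_times)

end
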